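(* Let $A$ be a $d\times n$ integer matrix with columns $a_1,\dots,a_n\in\mathbb{Z}^d$, and assume there is $l\in\mathbb{R}^d$ with $\langle l,a_i\rangle<0$ for all $i$. Let $\Lambda\subset\mathbb{Z}^n$ be a lattice (subgroup) such that $A\lambda=0$ for all $\lambda\in\Lambda$. Let $S$ be the neighborhood complex on $\Lambda$ (defined below) and $\bar S$ a set of distinct representatives of $S$ modulo $\Lambda$, and define \[f_{\bar S}(\mathbf{z})=\frac{\sum_{s\in\bar S}(-1)^{\dim(s)}\mathbf{z}^{A\cdot\max(s)}}{\prod_{i=1}^n(1-\mathbf{z}^{a_i})}.\] For $b\in\mathbb{Z}^d$ let $T_b=\{\xi\in\mathbb{Z}^n:\ \xi\ge0,\ A\xi=b\}$, with the equivalence relation $\xi\sim\eta$ iff $\xi-\eta\in\Lambda$, and let $c_b$ be the number of equivalence classes of $T_b$. Then \[f_{\bar S}(\mathbf{z})=\sum_{b\in\mathbb{Z}^d}c_b\mathbf{z}^b.\]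
   Context: Notation: $\mathbf{z}^b=z_1^{b_1}\cdots z_d^{b_d}$. $f_{\bar S}$ is understood as a Laurent series in $\mathbf{z}$ by expanding each $1/(1-\mathbf{z}^{a_i})$ as $\sum_{k\ge0}\mathbf{z}^{ka_i}$ (convergent near $(e^{l_1},\dots,e^{l_d})$). For vectors, $x\le y$ means coordinatewise $\le$, and $x<y$ means $x_i<y_i$ for all $i$. For a finite set $s\subset\mathbb{R}^n$, $\max(s)$ is the coordinatewise maximum. A simplicial complex is a collection of nonempty finite subsets of the vertex set closed under taking nonempty subsets; $\dim(s)=|s|-1$. $\Lambda$ is generic if whenever a nonzero $\lambda\in\Lambda$ has $\lambda_i=0$ for some $i$, there is $\lambda'\in\Lambda$ with $\lambda'<\max(\lambda,0)$. A proper perturbation is a map $\varphi:\Lambda\to\mathbb{R}^n$ such that for all $x,y\in\Lambda$ and all $i$: (1) if $x\ne y$ then $[\varphi(x)]_i\ne[\varphi(y)]_i$; (2) if $[\varphi(x)]_i<[\varphi(y)]_i$ then $x_i\le y_i$; (3) if $[\varphi(x)]_i<[\varphi(y)]_i$ then $[\varphi(x+\lambda)]_i<[\varphi(y+\lambda)]_i$ for all $\lambda\in\Lambda$. Neighborhood complex $S$ (vertices $\Lambda$): if $\Lambda$ is generic, a nonempty finite $s\subset\Lambda$ is in $S$ iff no $\lambda\in\Lambda$ satisfies $\lambda<\max(s)$; if $\Lambda$ is not generic, fix any proper perturbation $\varphi$ and let $s\in S$ iff no $\lambda\in\Lambda$ satisfies $\varphi(\lambda)<\max(\varphi(s))$,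 where $\varphi(s)=\{\varphi(\lambda):\lambda\in s\}$. $S$ is invariant under translation by $\Lambda$, and $\bar S$ contains exactly one simplex from each translation class. *)

theory Defs
  imports "HOL-Analysis.Analysis"
begin

text \<open>The order \<open><\<close> that the library provides on vectors is \<open>x \<le> y \<and> x \<noteq> y\<close>; the strict
  relation needed here is strict in every coordinate. The library's \<open>\<le>\<close> is coordinatewise.\<close>

definition vec_less :: "'a::linorder ^ 'n \<Rightarrow> 'a ^ 'n \<Rightarrow> bool"  (infix "\<lless>" 50)
  where "x \<lless> y \<longleftrightarrow> (\<forall>i. x $ i < y $ i)"

definition vec_max :: "('a::linorder ^ 'n) set \<Rightarrow> 'a ^ 'n"
  where "vec_max s = (\<chi> i. Max ((\<lambda>x. x $ i) ` s))"

definition is_lattice :: "(int ^ 'n) set \<Rightarrow> bool"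
  where "is_lattice \<Lambda> \<longleftrightarrow> 0 \<in> \<Lambda> \<and> (\<forall>x\<in>\<Lambda>. \<forall>y\<in>\<Lambda>. x + y \<in> \<Lambda>) \<and> (\<forall>x\<in>\<Lambda>. - x \<in> \<Lambda>)"


section \<open>The neighborhood complex\<close>

definition generic :: "(int ^ 'n) set \<Rightarrow> bool"
  where "generic \<Lambda> \<longleftrightarrow>
    (\<forall>v\<in>\<Lambda>. v \<noteq> 0 \<and> (\<exists>i. v $ i = 0) \<longrightarrow> (\<exists>w\<in>\<Lambda>. w \<lless> vec_max {v, 0}))"

definition proper_perturbation :: "(int ^ 'n) set \<Rightarrow> (int ^ 'n \<Rightarrow> real ^ 'n) \<Rightarrow> bool"
  where "proper_perturbation \<Lambda> \<phi> \<longleftrightarrow>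
    (\<forall>x\<in>\<Lambda>. \<forall>y\<in>\<Lambda>. \<forall>i.
      (x \<noteq> y \<longrightarrow> \<phi> x $ i \<noteq> \<phi> y $ i) \<and>
      (\<phi> x $ i < \<phi> y $ i \<longrightarrow> x $ i \<le> y $ i) \<and>
      (\<phi> x $ i < \<phi> y $ i \<longrightarrow> (\<forall>v\<in>\<Lambda>. \<phi> (x + v) $ i < \<phi> (y + v) $ i)))"

text \<open>The argument \<open>\<phi>\<close> is irrelevant when \<open>\<Lambda>\<close> is generic.\<close>

definition neighborhood_complex ::
    "(int ^ 'n) set \<Rightarrow> (int ^ 'n \<Rightarrow> real ^ 'n) \<Rightarrow> (int ^ 'n) set set"
  where "neighborhood_complex \<Lambda> \<phi> =
    {s. finite s \<and> s \<noteq> {} \<and> s \<subseteq> \<Lambda> \<and>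
        (if generic \<Lambda> then \<not> (\<exists>v\<in>\<Lambda>. v \<lless> vec_max s)
         else \<not> (\<exists>v\<in>\<Lambda>. \<phi> v \<lless> vec_max (\<phi> ` s)))}"

definition simplex_dim :: "'a set \<Rightarrow> nat"
  where "simplex_dim s = card s - 1"

definition representatives ::
    "(int ^ 'n) set \<Rightarrow> (int ^ 'n) set set \<Rightarrow> (int ^ 'n) set set \<Rightarrow> bool"
  where "representatives \<Lambda> S Sbar \<longleftrightarrow>
    Sbar \<subseteq> S \<and> (\<forall>s\<in>S. \<exists>!t. t \<in> Sbar \<and> (\<exists>v\<in>\<Lambda>. t = (\<lambda>x. x + v) ` s))"


section \<open>Laurent series in several variables\<close>

text \<open>A formal Laurent series \<open>\<Sum>\<^sub>b f\<^sub>b z\<^sup>b\<close> is its family of coefficients \<open>b \<mapsto> f\<^sub>b\<close>. Products are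
  Cauchy products; they make sense only when each coefficient is a finite sum, which the predicates
  ending in \<open>_defined\<close> express (the library's sum over an infinite set is 0).\<close>

type_synonym 'd laurent = "int ^ 'd \<Rightarrow> int"

definition laurent_mult :: "'d laurent \<Rightarrow> 'd laurent \<Rightarrow> 'd::finite laurent"
  where "laurent_mult f g = (\<lambda>b. \<Sum>u | f u \<noteq> 0 \<and> g (b - u) \<noteq> 0. f u * g (b - u))"

definition laurent_mult_defined :: "'d laurent \<Rightarrow> 'd::finite laurent \<Rightarrow> bool"
  where "laurent_mult_defined f g \<longleftrightarrow> (\<forall>b. finite {u. f u \<noteq> 0 \<and> g (b - u) \<noteq> 0})"

definition laurent_prod :: "('n::finite \<Rightarrow> 'd::finite laurent) \<Rightarrow> 'd laurent"
  where "laurent_prod F =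
    (\<lambda>b. \<Sum>u | (\<Sum>i\<in>UNIV. u i) = b \<and> (\<forall>i. F i (u i) \<noteq> 0). \<Prod>i\<in>UNIV. F i (u i))"

definition laurent_prod_defined :: "('n::finite \<Rightarrow> 'd::finite laurent) \<Rightarrow> bool"
  where "laurent_prod_defined F \<longleftrightarrow>
    (\<forall>b. finite {u. (\<Sum>i\<in>UNIV. u i) = b \<and> (\<forall>i. F i (u i) \<noteq> 0)})"

text \<open>The expansion of \<open>1 / (1 - z\<^sup>a)\<close> as \<open>\<Sum>k\<ge>0. z\<^bsup>ka\<^esup>\<close>, for \<open>a \<noteq> 0\<close>.\<close>

definition geometric_series :: "int ^ 'd \<Rightarrow> 'd::finite laurent"
  where "geometric_series a = (\<lambda>b. int (card {k::nat. b = int k *s a}))"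


section \<open>The two sides of the identity\<close>

text \<open>The set of representatives can be infinite for some proper perturbations, so the numerator
  \<open>\<Sum>s. (-1)\<^bsup>dim s\<^esup> z\<^bsup>A max s\<^esup>\<close> is itself a series.\<close>

definition numerator_series :: "int ^ 'n ^ 'd \<Rightarrow> (int ^ 'n) set set \<Rightarrow> 'd::finite laurent"
  where "numerator_series A Sbar =
    (\<lambda>b. \<Sum>s | s \<in> Sbar \<and> A *v vec_max s = b. (- 1) ^ simplex_dim s)"

definition f_series :: "int ^ 'n ^ 'd \<Rightarrow> (int ^ 'n) set set \<Rightarrow> 'd::finite laurent"
  where "f_series A Sbar =
    laurent_mult (numerator_series A Sbar) (laurent_prod (\<lambda>i. geometric_series (column i A)))"

definition f_series_defined :: "int ^ 'n ^ 'd::finite \<Rightarrow> (int ^ 'n) set set \<Rightarrow> bool"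
  where "f_series_defined A Sbar \<longleftrightarrow>
    (\<forall>b. finite {s. s \<in> Sbar \<and> A *v vec_max s = b}) \<and>
    laurent_prod_defined (\<lambda>i. geometric_series (column i A)) \<and>
    laurent_mult_defined (numerator_series A Sbar)
      (laurent_prod (\<lambda>i. geometric_series (column i A)))"

definition fiber :: "int ^ 'n ^ 'd \<Rightarrow> int ^ 'd \<Rightarrow> (int ^ 'n) set"
  where "fiber A b = {\<xi>. 0 \<le> \<xi> \<and> A *v \<xi> = b}"

definition num_classes :: "int ^ 'n ^ 'd \<Rightarrow> (int ^ 'n) set \<Rightarrow> int ^ 'd \<Rightarrow> nat"
  where "num_classes A \<Lambda> b =
    card (fiber A b // {(\<xi>, \<eta>). \<xi> \<in> fiber A b \<and> \<eta> \<in> fiber A b \<and> \<xi> - \<eta> \<in> \<Lambda>})"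

end

theory Submission
  imports Defs
begin

text \<open>
  Expanding the product, the coefficient of \<open>z\<^sup>b\<close> in \<open>f\<close> is the sum of \<open>(-1)\<^bsup>dim s\<^esup>\<close> over all pairs of
  \<open>s \<in> Sbar\<close> and \<open>\<eta> \<ge> 0\<close> with \<open>A (max s + \<eta>) = b\<close>. Grouping the pairs by the coset \<open>\<xi> + \<Lambda>\<close> of
  \<open>max s + \<eta>\<close>, and moving \<open>s\<close> within its translation class, the contribution of a coset is the Euler
  characteristic of the subcomplex of all \<open>t \<in> S\<close> with \<open>max t \<le> \<xi>\<close>. A coset that contributes meets
  the nonnegative vectors, so we may take \<open>\<xi> \<ge> 0\<close>; the Euler characteristic is then 1. Indeed,
  the subcomplex consists of those nonempty subsets \<open>s\<close> of the finite set \<open>{v \<in> \<Lambda>. v \<le> \<xi>}\<close> for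
  which no lattice point lies strictly below \<open>max s\<close>, and the remaining subsets cancel: choose
  a lattice point strictly below \<open>max s\<close>, depending on \<open>max s\<close> only, and add it to \<open>s\<close> or remove it
  from \<open>s\<close>, which leaves \<open>max s\<close> unchanged.
\<close>

section \<open>Sign-reversing involutions and the Euler characteristic\<close>

text \<open>Reindexing along \<open>h\<close>, its own inverse on \<open>X\<close>, turns the sum
  into its negative, and an integer equal to its negative is 0.\<close>

lemma sum_involution_neg:
  fixes f :: "'a \<Rightarrow> int"
  assumes "\<And>x. x \<in> X \<Longrightarrow> h x \<in> X" "\<And>x. x \<in> X \<Longrightarrow> h (h x) = x"
    and "\<And>x. x \<in> X \<Longrightarrow> f (h x) = - f x"
  shows "sum f X = 0"
proof -
  have "sum f X = (\<Sum>x\<in>X. - f x)"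
    by (rule sum.reindex_bij_witness[where i = h and j = h]) (use assms in auto)
  then show ?thesis
    by (simp add: sum_negf)
qed

definition toggle :: "'a \<Rightarrow> 'a set \<Rightarrow> 'a set"
  where "toggle x s = (if x \<in> s then s - {x} else insert x s)"

lemma toggle_toggle [simp]: "toggle x (toggle x s) = s"
  by (auto simp: toggle_def)

lemma neg_one_power_card_toggle:
  assumes "finite s"
  shows "(- 1 :: int) ^ card (toggle x s) = - ((- 1) ^ card s)"
proof (cases "x \<in> s")
  case True
  then have card: "card s = Suc (card (s - {x}))"
    using assms by (intro card.remove)
  have "toggle x s = s - {x}"
    using True by (simp add: toggle_def)
  then show ?thesis
    unfolding card by (simp only: power_Suc)
qed (use assms in \<open>simp add: toggle_def\<close>)

lemma neg_one_power_simplex_dim: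
  assumes "finite s" "s \<noteq> {}"
  shows "(- 1 :: int) ^ simplex_dim s = - ((- 1) ^ card s)"
proof -
  have "card s = Suc (simplex_dim s)"
    using assms by (simp add: simplex_dim_def card_gt_0_iff)
  then show ?thesis by simp
qed

text \<open>Each \<open>L i\<close> abstracts one coordinate comparison, so that the generic and the
  perturbed case are treated together. Signed by \<open>card\<close>, both the sum over all subsets
  of \<open>V\<close> and the sum over the dominated ones vanish, hence so does the sum over the
  rest. There the empty set contributes 1, and passing to \<open>simplex_dim\<close> flips the sign
  of the others.\<close>

lemma euler_characteristic_undominated:
  fixes L :: "'i \<Rightarrow> 'a \<Rightarrow> 'a \<Rightarrow> bool"
  assumes V: "finite V" "V \<noteq> {}"
    and irrefl: "\<And>i x. \<not> L i x x"
    and trans: "\<And>i x y z. L i x y \<Longrightarrow> L i y z \<Longrightarrow> L i x z"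
  shows "(\<Sum>s | s \<subseteq> V \<and> s \<noteq> {} \<and> \<not> (\<exists>x\<in>V. \<forall>i. \<exists>y\<in>s. L i x y). (- 1 :: int) ^ simplex_dim s) = 1"
proof -
  define D where "D s = {x \<in> V. \<forall>i. \<exists>y\<in>s. L i x y}" for s
  \<comment> \<open>\<open>c s\<close> depends on \<open>s\<close> only through \<open>D s\<close>,
    which toggling preserves. The same point is therefore chosen again after the toggle, which makes
    the map an involution.\<close>
  define c where "c s = (SOME x. x \<in> D s)" for s
  have fin: "finite s" if "s \<subseteq> V" for s
    using that V finite_subset by blast
  have D_empty: "D {} = {}"
    by (auto simp: D_def)
  \<comment> \<open>Toggling affects only \<open>x\<close> as a witness. In each coordinate some
    \<open>w\<close> in \<open>s\<close> lies above \<open>x\<close>; by irreflexivity it differs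
    from \<open>x\<close> and survives the toggle, and by transitivity it can replace
    \<open>x\<close>.\<close>
  have D_toggle: "D (toggle x s) = D s" if "x \<in> D s" for x s
  proof -
    have "\<exists>y\<in>toggle x s. L i z y" if z: "\<exists>y\<in>s. L i z y" for i z
    proof -
      obtain y where y: "y \<in> s" "L i z y" using z by blast
      obtain w where w: "w \<in> s" "L i x w" using \<open>x \<in> D s\<close> by (auto simp: D_def)
      have "w \<noteq> x" using w irrefl by blast
      then have "w \<in> toggle x s" using w by (auto simp: toggle_def)
      moreover have "y \<in> toggle x s \<or> y = x" using y by (auto simp: toggle_def)
      ultimately show ?thesis using y w trans by blast
    qed
    moreover have "\<exists>y\<in>s. L i z y" if z: "\<exists>y\<in>toggle x s. L i z y" for i z
    proof -
      obtain y where y: "y \<in> toggle x s" "L i z y" using z by blast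
      obtain w where w: "w \<in> s" "L i x w" using \<open>x \<in> D s\<close> by (auto simp: D_def)
      have "y \<in> s \<or> y = x" using y by (auto simp: toggle_def split: if_splits)
      then show ?thesis using y w trans by blast
    qed
    ultimately show ?thesis
      unfolding D_def by blast
  qed
  have c: "c s \<in> D s" if "D s \<noteq> {}" for s
    using that unfolding c_def by (simp add: some_in_eq)
  have toggle_sub: "toggle x s \<subseteq> V" if "x \<in> V" "s \<subseteq> V" for x s
    using that by (auto simp: toggle_def)
  have dominated: "(\<Sum>s | s \<subseteq> V \<and> D s \<noteq> {}. (- 1 :: int) ^ card s) = 0"
  proof (rule sum_involution_neg[where h = "\<lambda>s. toggle (c s) s"])
    fix s assume s: "s \<in> {s. s \<subseteq> V \<and> D s \<noteq> {}}"
    have *: "D (toggle (c s) s) = D s"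
      using s by (intro D_toggle c) simp
    have "c s \<in> V"
      using s c[of s] by (auto simp: D_def)
    then show "toggle (c s) s \<in> {s. s \<subseteq> V \<and> D s \<noteq> {}}"
      using s toggle_sub by (simp add: *)
    have "c (toggle (c s) s) = c s"
      using * by (simp add: c_def)
    then show "toggle (c (toggle (c s) s)) (toggle (c s) s) = s"
      by simp
    show "(- 1 :: int) ^ card (toggle (c s) s) = - ((- 1) ^ card s)"
      using s fin by (intro neg_one_power_card_toggle) auto
  qed
  obtain v where v: "v \<in> V" using V by blast
  have "(\<Sum>s | s \<subseteq> V. (- 1 :: int) ^ card s) = 0"
    by (rule sum_involution_neg[where h = "toggle v"])
      (use v toggle_sub fin in \<open>auto intro: neg_one_power_card_toggle\<close>)
  also have "{s. s \<subseteq> V} = {s. s \<subseteq> V \<and> D s \<noteq> {}} \<union> {s. s \<subseteq> V \<and> D s = {}}"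
    by blast
  also have "(\<Sum>s \<in> \<dots>. (- 1 :: int) ^ card s)
      = (\<Sum>s | s \<subseteq> V \<and> D s \<noteq> {}. (- 1) ^ card s) + (\<Sum>s | s \<subseteq> V \<and> D s = {}. (- 1) ^ card s)"
    by (rule sum.union_disjoint) (use V in auto)
  also have "{s. s \<subseteq> V \<and> D s = {}} = insert {} {s. s \<subseteq> V \<and> s \<noteq> {} \<and> D s = {}}"
    using D_empty by auto
  also have "(\<Sum>s \<in> \<dots>. (- 1 :: int) ^ card s)
      = 1 + (\<Sum>s | s \<subseteq> V \<and> s \<noteq> {} \<and> D s = {}. (- 1) ^ card s)"
    using V by (subst sum.insert) auto
  finally have "1 = (\<Sum>s | s \<subseteq> V \<and> s \<noteq> {} \<and> D s = {}. - ((- 1 :: int) ^ card s))"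
    using dominated by (simp add: sum_negf)
  also have "\<dots> = (\<Sum>s | s \<subseteq> V \<and> s \<noteq> {} \<and> D s = {}. (- 1) ^ simplex_dim s)"
    by (intro sum.cong refl neg_one_power_simplex_dim[symmetric]) (use fin in auto)
  also have "{s. s \<subseteq> V \<and> s \<noteq> {} \<and> D s = {}}
      = {s. s \<subseteq> V \<and> s \<noteq> {} \<and> \<not> (\<exists>x\<in>V. \<forall>i. \<exists>y\<in>s. L i x y)}"
    by (auto simp: D_def)
  finally show ?thesis by simp
qed

section \<open>Coordinatewise maxima and their translates\<close>

lemma vec_max_le_iff:
  assumes "finite s" "s \<noteq> {}"
  shows "vec_max s \<le> \<xi> \<longleftrightarrow> (\<forall>x\<in>s. x \<le> \<xi>)"
  using assms by (auto simp: less_eq_vec_def vec_max_def)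

lemma le_vec_max:
  assumes "finite s" "x \<in> s"
  shows "x \<le> vec_max s"
  using assms by (auto simp: less_eq_vec_def vec_max_def)

lemma vec_less_vec_max_iff:
  assumes "finite s" "s \<noteq> {}"
  shows "x \<lless> vec_max s \<longleftrightarrow> (\<forall>i. \<exists>y\<in>s. x $ i < y $ i)"
  using assms by (auto simp: vec_less_def vec_max_def Max_gr_iff)

lemma vec_max_translate:
  fixes v :: "int ^ 'n"
  assumes "finite s" "s \<noteq> {}"
  shows "vec_max ((\<lambda>x. x + v) ` s) = vec_max s + v"
proof -
  have "Max ((\<lambda>x. x $ i + v $ i) ` s) = Max ((\<lambda>x. x $ i) ` s) + v $ i" for i
    by (rule Max_add_commute) (use assms in auto)
  then show ?thesis
    by (simp add: vec_max_def vec_eq_iff image_image)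
qed

lemma simplex_dim_translate:
  fixes v :: "'a::group_add"
  shows "simplex_dim ((\<lambda>x. x + v) ` s) = simplex_dim s"
  by (simp add: simplex_dim_def card_image)


lemma int_vec_scale_right_cancel:
  fixes x :: "int ^ 'n"
  assumes "a *s x = b *s x" "x \<noteq> 0"
  shows "a = b"
  using assms by (auto simp: vec_eq_iff)


section \<open>Fibers and the product of geometric series\<close>

lemma finite_int_vec_box: "finite {\<xi> :: int ^ 'n. \<forall>i. \<xi> $ i \<in> {0..m i}}"
proof (rule finite_subset)
  show "{\<xi> :: int ^ 'n. \<forall>i. \<xi> $ i \<in> {0..m i}} \<subseteq> vec_lambda ` (\<Pi>\<^sub>E i\<in>UNIV. {0..m i})"
  proof
    fix \<xi> :: "int ^ 'n" assume "\<xi> \<in> {\<xi>. \<forall>i. \<xi> $ i \<in> {0..m i}}"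
    then have "vec_nth \<xi> \<in> (\<Pi>\<^sub>E i\<in>UNIV. {0..m i})" by auto
    then show "\<xi> \<in> vec_lambda ` (\<Pi>\<^sub>E i\<in>UNIV. {0..m i})"
      by (metis image_eqI vec_nth_inverse)
  qed
  show "finite (vec_lambda ` (\<Pi>\<^sub>E i\<in>(UNIV :: 'n set). {0..m i}))"
    by (intro finite_imageI finite_PiE) auto
qed

locale negative_functional =
  fixes A :: "int ^ 'n ^ 'd" and l :: "real ^ 'd"
  assumes neg: "\<And>i. l \<bullet> (\<chi> j. real_of_int (column i A $ j)) < 0"
begin

text \<open>Pairing \<open>A *v \<xi> = b\<close> with \<open>- l\<close> writes the constant
  \<open>B\<close> as a combination of the coordinates of \<xi> with positive weights
  \<open>w i\<close>. For nonnegative \<xi> no single term exceeds \<open>B\<close>, which bounds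
  every coordinate.\<close>

lemma finite_fiber: "finite (fiber A b)"
proof -
  define w where "w i = - (l \<bullet> (\<chi> j. real_of_int (column i A $ j)))" for i
  define B where "B = - (l \<bullet> (\<chi> j. real_of_int (b $ j)))"
  have w: "w i > 0" for i
    using neg by (simp add: w_def)
  have "\<xi> $ i \<in> {0..\<lceil>B / w i\<rceil>}" if "\<xi> \<in> fiber A b" for \<xi> i
  proof -
    have nonneg: "\<xi> $ k \<ge> 0" for k
      using that by (auto simp: fiber_def less_eq_vec_def)
    have b: "b = (\<Sum>k\<in>UNIV. (\<xi> $ k) *s column k A)"
      using that by (simp add: fiber_def matrix_mult_sum)
    have "B = (\<Sum>k\<in>UNIV. real_of_int (\<xi> $ k) * w k)"
      unfolding B_def b w_def inner_vec_def
      by (simp add: sum_distrib_left sum_negf mult_ac) (subst sum.swap, rule refl)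
    moreover have "real_of_int (\<xi> $ i) * w i \<le> (\<Sum>k\<in>UNIV. real_of_int (\<xi> $ k) * w k)"
      by (rule member_le_sum) (use nonneg w in \<open>auto intro!: mult_nonneg_nonneg simp: less_imp_le\<close>)
    ultimately have "real_of_int (\<xi> $ i) \<le> B / w i"
      using w by (simp add: pos_le_divide_eq)
    then show ?thesis
      using nonneg by (simp add: le_ceiling_iff)
  qed
  then show ?thesis
    using finite_subset[OF _ finite_int_vec_box[of "\<lambda>i. \<lceil>B / w i\<rceil>"]] by blast
qed

lemma column_nonzero: "column i A \<noteq> 0"
  using neg[of i] by (auto simp: zero_vec_def[symmetric])

text \<open>A nonzero column has distinct multiples, so at most one \<open>k\<close> yields a given
  exponent.\<close>

lemma geometric_series_eq:
  "geometric_series (column i A) c = (if \<exists>k::nat. c = int k *s column i A then 1 else 0)"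
proof (cases "\<exists>k::nat. c = int k *s column i A")
  case True
  then obtain k where k: "c = int k *s column i A" by blast
  have "k' = k" if "c = int k' *s column i A" for k'
    using that k int_vec_scale_right_cancel[OF _ column_nonzero] by (metis of_nat_eq_iff)
  then have "{k. c = int k *s column i A} = {k}"
    using k by auto
  then show ?thesis
    using True by (simp add: geometric_series_def)
qed (simp add: geometric_series_def)

text \<open>Choosing a monomial from each geometric series amounts to choosing its multiplicity, and
  the multiplicities are the coordinates of a fiber point. The coefficient of the product at
  \<open>b\<close> will therefore count the fiber.\<close>

lemma bij_betw_fiber:
  "bij_betw (\<lambda>\<xi> i. (\<xi> $ i) *s column i A) (fiber A b)
    {u. (\<Sum>i\<in>UNIV. u i) = b \<and> (\<forall>i. geometric_series (column i A) (u i) \<noteq> 0)}"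
    (is "bij_betw ?f _ ?U")
proof (rule bij_betw_imageI)
  show "inj_on ?f (fiber A b)"
    by (rule inj_onI, simp add: fun_eq_iff, subst vec_eq_iff)
      (use int_vec_scale_right_cancel[OF _ column_nonzero] in blast)
  show "?f ` fiber A b = ?U"
  proof (intro subset_antisym subsetI)
    fix u assume "u \<in> ?f ` fiber A b"
    then obtain \<xi> where \<xi>: "\<xi> \<in> fiber A b" "u = ?f \<xi>" by blast
    then have "\<xi> $ i = int (nat (\<xi> $ i))" for i
      by (simp add: fiber_def less_eq_vec_def)
    then have "\<exists>k::nat. u i = int k *s column i A" for i
      using \<xi>(2) by metis
    then show "u \<in> ?U"
      using \<xi> by (simp add: geometric_series_eq fiber_def matrix_mult_sum)
  next
    fix u assume u: "u \<in> ?U"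
    then have "\<exists>k::nat. u i = int k *s column i A" for i
      by (auto simp: geometric_series_eq split: if_splits)
    then obtain k :: "'n \<Rightarrow> nat" where k: "\<And>i. u i = int (k i) *s column i A"
      by metis
    define \<xi> :: "int ^ 'n" where "\<xi> = (\<chi> i. int (k i))"
    have "u = ?f \<xi>"
      using k by (simp add: \<xi>_def fun_eq_iff)
    moreover have "\<xi> \<in> fiber A b"
      using u k by (simp add: fiber_def \<xi>_def less_eq_vec_def matrix_mult_sum)
    ultimately show "u \<in> ?f ` fiber A b" by blast
  qed
qed

lemma laurent_prod_defined_geometric:
  "laurent_prod_defined (\<lambda>i. geometric_series (column i A))"
  unfolding laurent_prod_defined_def
  using bij_betw_finite[OF bij_betw_fiber] finite_fiber by blast

lemma laurent_prod_geometric: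
  "laurent_prod (\<lambda>i. geometric_series (column i A)) b = int (card (fiber A b))"
proof -
  let ?U = "{u. (\<Sum>i\<in>UNIV. u i) = b \<and> (\<forall>i. geometric_series (column i A) (u i) \<noteq> 0)}"
  have "laurent_prod (\<lambda>i. geometric_series (column i A)) b = (\<Sum>u\<in>?U. 1)"
    unfolding laurent_prod_def
    by (intro sum.cong refl prod.neutral) (auto simp: geometric_series_eq split: if_splits)
  also have "\<dots> = int (card (fiber A b))"
    using bij_betw_same_card[OF bij_betw_fiber[of b]] by simp
  finally show ?thesis .
qed

end


section \<open>The neighborhood complex of a family of translation-invariant orders\<close>

text \<open>\<open>below i\<close> stands for the comparison of the \<open>i\<close>-th coordinates: that of the vectors
  themselves if the lattice is generic, that of their perturbations otherwise.\<close>

locale neighborhood = negative_functional A l for A :: "int ^ 'n ^ 'd" and l +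
  fixes \<Lambda> :: "(int ^ 'n) set" and below :: "'n \<Rightarrow> int ^ 'n \<Rightarrow> int ^ 'n \<Rightarrow> bool"
  assumes lattice: "is_lattice \<Lambda>"
    and kernel: "\<And>v. v \<in> \<Lambda> \<Longrightarrow> A *v v = 0"
    and below_irrefl: "\<And>i x. \<not> below i x x"
    and below_trans: "\<And>i x y z. below i x y \<Longrightarrow> below i y z \<Longrightarrow> below i x z"
    and below_le: "\<And>i x y. x \<in> \<Lambda> \<Longrightarrow> y \<in> \<Lambda> \<Longrightarrow> below i x y \<Longrightarrow> x $ i \<le> y $ i"
    and below_add: "\<And>i x y v. x \<in> \<Lambda> \<Longrightarrow> y \<in> \<Lambda> \<Longrightarrow> v \<in> \<Lambda> \<Longrightarrow> below i x y \<Longrightarrow>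
      below i (x + v) (y + v)"
begin

text \<open>The neighborhood complex with the maximum unfolded: a point is strictly below it iff in
  each coordinate some element of \<open>s\<close> is above the point, so only the relations
  \<open>below i\<close> enter.\<close>

definition S :: "(int ^ 'n) set set"
  where "S = {s. finite s \<and> s \<noteq> {} \<and> s \<subseteq> \<Lambda> \<and> \<not> (\<exists>v\<in>\<Lambda>. \<forall>i. \<exists>y\<in>s. below i v y)}"

lemma zero_in: "0 \<in> \<Lambda>"
  and add_in: "x \<in> \<Lambda> \<Longrightarrow> y \<in> \<Lambda> \<Longrightarrow> x + y \<in> \<Lambda>"
  and minus_in: "x \<in> \<Lambda> \<Longrightarrow> - x \<in> \<Lambda>"
  using lattice by (auto simp: is_lattice_def)

lemma diff_in: "x \<in> \<Lambda> \<Longrightarrow> y \<in> \<Lambda> \<Longrightarrow> x - y \<in> \<Lambda>"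
  using add_in[OF _ minus_in] by fastforce

text \<open>As \<open>A\<close> vanishes on \<Lambda>, subtraction from \<xi> embeds this set into
  the finite fiber over \<open>A *v \<xi>\<close>.\<close>

lemma finite_le: "finite {x \<in> \<Lambda>. x \<le> \<xi>}"
proof -
  have "(\<lambda>x. \<xi> - x) ` {x \<in> \<Lambda>. x \<le> \<xi>} \<subseteq> fiber A (A *v \<xi>)"
    using kernel by (auto simp: fiber_def less_eq_vec_def matrix_vector_mult_diff_distrib)
  then have "finite ((\<lambda>x. \<xi> - x) ` {x \<in> \<Lambda>. x \<le> \<xi>})"
    using finite_fiber finite_subset by blast
  then show ?thesis
    by (rule finite_imageD) (auto simp: inj_on_def)
qed

lemma translate_S:
  assumes "s \<in> S" "v \<in> \<Lambda>"
  shows "(\<lambda>x. x + v) ` s \<in> S"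
proof -
  have False if w: "w \<in> \<Lambda>" "\<forall>i. \<exists>y\<in>(\<lambda>x. x + v) ` s. below i w y" for w
  proof -
    have "\<exists>y\<in>s. below i (w - v) y" for i
    proof -
      obtain y where y: "y \<in> s" "below i w (y + v)" using w by blast
      then have "below i (w + - v) (y + v + - v)"
        using assms w by (intro below_add minus_in add_in) (auto simp: S_def)
      then show ?thesis using y by auto
    qed
    then show False
      using assms(1) diff_in[OF w(1) assms(2)] unfolding S_def by blast
  qed
  moreover have "finite ((\<lambda>x. x + v) ` s)" "(\<lambda>x. x + v) ` s \<noteq> {}" "(\<lambda>x. x + v) ` s \<subseteq> \<Lambda>"
    using assms add_in by (auto simp: S_def)
  ultimately show ?thesis
    unfolding S_def by blast
qed

lemma euler_characteristic:
  assumes "0 \<le> \<xi>"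
  shows "(\<Sum>s | s \<in> S \<and> vec_max s \<le> \<xi>. (- 1 :: int) ^ simplex_dim s) = 1"
proof -
  define V where "V = {x \<in> \<Lambda>. x \<le> \<xi>}"
  \<comment> \<open>Nonnegativity of \<xi> puts 0 into \<open>V\<close>; for empty \<open>V\<close>
    the sum would be 0.\<close>
  have V: "finite V" "V \<noteq> {}"
    using assms zero_in finite_le by (auto simp: V_def)
  \<comment> \<open>By \<open>below_le\<close>, a lattice point that is below some element of
    \<open>s\<close> in every coordinate is itself \<le> \<xi>. Searching for such points in
    \<open>V\<close> or in all of \<Lambda> thus gives the same condition.\<close>
  have "x \<in> V" if x: "s \<subseteq> V" "x \<in> \<Lambda>" "\<forall>i. \<exists>y\<in>s. below i x y" for x s
  proof -
    have "x $ i \<le> \<xi> $ i" for i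
    proof -
      obtain y where "y \<in> s" "below i x y" using x by blast
      then have "x $ i \<le> y $ i" "y $ i \<le> \<xi> $ i"
        using x below_le by (auto simp: V_def less_eq_vec_def)
      then show ?thesis by simp
    qed
    then show ?thesis using x by (simp add: V_def less_eq_vec_def)
  qed
  moreover have "V \<subseteq> \<Lambda>" by (auto simp: V_def)
  ultimately have dom: "(\<exists>x\<in>V. \<forall>i. \<exists>y\<in>s. below i x y) \<longleftrightarrow> (\<exists>x\<in>\<Lambda>. \<forall>i. \<exists>y\<in>s. below i x y)"
    if "s \<subseteq> V" for s
    using that by blast
  have sub: "s \<subseteq> V \<longleftrightarrow> s \<subseteq> \<Lambda> \<and> vec_max s \<le> \<xi>" if "finite s" "s \<noteq> {}" for s
    using that by (auto simp: V_def vec_max_le_iff)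
  have "{s. s \<in> S \<and> vec_max s \<le> \<xi>}
      = {s. s \<subseteq> V \<and> s \<noteq> {} \<and> \<not> (\<exists>x\<in>V. \<forall>i. \<exists>y\<in>s. below i x y)}"
  proof (rule Collect_cong)
    fix s
    show "s \<in> S \<and> vec_max s \<le> \<xi> \<longleftrightarrow>
        s \<subseteq> V \<and> s \<noteq> {} \<and> \<not> (\<exists>x\<in>V. \<forall>i. \<exists>y\<in>s. below i x y)"
      using dom[of s] sub[of s] finite_subset[OF _ V(1), of s] unfolding S_def by blast
  qed
  then show ?thesis
    using euler_characteristic_undominated[OF V, of below] below_irrefl below_trans by metis
qed

text \<open>Subtracting any vertex \<open>x\<close> of \<open>s\<close> works, because
  \<open>x\<close> \<le> \<open>vec_max s\<close>.\<close>

lemma translate_nonneg: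
  assumes "s \<in> S"
  obtains v where "v \<in> \<Lambda>" "0 \<le> vec_max s + v"
proof -
  obtain x where x: "x \<in> s" using assms by (auto simp: S_def)
  have s: "finite s" "x \<in> \<Lambda>"
    using assms x by (auto simp: S_def)
  have "0 \<le> vec_max s + - x"
    using le_vec_max[OF s(1) x] by (simp add: less_eq_vec_def)
  then show ?thesis
    using that minus_in s(2) by blast
qed

end

section \<open>Representatives modulo the lattice and the coefficients of the series\<close>

locale neighborhood_representatives = neighborhood A l \<Lambda> below
  for A :: "int ^ 'n ^ 'd" and l \<Lambda> and below +
  fixes Sbar
  assumes reps: "representatives \<Lambda> S Sbar"
begin

definition rep :: "(int ^ 'n) set \<Rightarrow> (int ^ 'n) set"
  where "rep s = (THE t. t \<in> Sbar \<and> (\<exists>v\<in>\<Lambda>. t = (\<lambda>x. x + v) ` s))"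

lemma Sbar_sub: "Sbar \<subseteq> S"
  using reps by (simp add: representatives_def)

lemma rep_translate:
  assumes "s \<in> S"
  shows "rep s \<in> Sbar" "\<exists>v\<in>\<Lambda>. rep s = (\<lambda>x. x + v) ` s"
proof -
  have "\<exists>!t. t \<in> Sbar \<and> (\<exists>v\<in>\<Lambda>. t = (\<lambda>x. x + v) ` s)"
    using reps assms by (simp add: representatives_def)
  from theI'[OF this] show "rep s \<in> Sbar" "\<exists>v\<in>\<Lambda>. rep s = (\<lambda>x. x + v) ` s"
    by (simp_all add: rep_def)
qed

lemma rep_of_translate:
  assumes "s \<in> Sbar" "v \<in> \<Lambda>"
  shows "rep ((\<lambda>x. x + v) ` s) = s"
proof -
  let ?t = "(\<lambda>x. x + v) ` s"
  have t: "?t \<in> S"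
    using assms Sbar_sub translate_S by blast
  have "s = (\<lambda>x. x + - v) ` ?t"
    by (simp add: image_image)
  then have "\<exists>w\<in>\<Lambda>. s = (\<lambda>x. x + w) ` ?t"
    using assms minus_in by blast
  moreover have "\<exists>!u. u \<in> Sbar \<and> (\<exists>w\<in>\<Lambda>. u = (\<lambda>x. x + w) ` ?t)"
    using reps t by (simp add: representatives_def)
  ultimately show ?thesis
    unfolding rep_def using assms by (intro the1_equality) auto
qed

lemma vec_max_translate_S:
  "s \<in> S \<Longrightarrow> vec_max ((\<lambda>x. x + v) ` s) = vec_max s + v"
  by (simp add: S_def vec_max_translate)

definition simplices :: "int ^ 'd \<Rightarrow> (int ^ 'n) set set"
  where "simplices u = {s. s \<in> Sbar \<and> A *v vec_max s = u}"

text \<open>Each such \<open>s\<close> has a translate with nonnegative maximum \<xi>. Here \<xi>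
  lies in the finite fiber over \<open>u\<close>, and the translate consists of lattice points \<le>
  \<xi>, so finitely many translates arise; \<open>rep\<close> recovers \<open>s\<close> from its
  translate.\<close>

lemma finite_simplices: "finite (simplices u)"
proof (rule finite_subset)
  show "simplices u \<subseteq> rep ` (\<Union>\<xi>\<in>fiber A u. Pow {x \<in> \<Lambda>. x \<le> \<xi>})"
  proof
    fix s assume s: "s \<in> simplices u"
    then have "s \<in> Sbar" "s \<in> S" using Sbar_sub by (auto simp: simplices_def)
    then obtain v where v: "v \<in> \<Lambda>" "0 \<le> vec_max s + v"
      using translate_nonneg by metis
    let ?t = "(\<lambda>x. x + v) ` s"
    have "?t \<in> S" using \<open>s \<in> S\<close> v translate_S by blast
    then have "?t \<subseteq> {x \<in> \<Lambda>. x \<le> vec_max ?t}"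
      using le_vec_max by (force simp: S_def)
    moreover have "vec_max ?t \<in> fiber A u"
      using s v kernel \<open>s \<in> S\<close>
      by (simp add: fiber_def vec_max_translate_S simplices_def matrix_vector_right_distrib)
    ultimately have "?t \<in> (\<Union>\<xi>\<in>fiber A u. Pow {x \<in> \<Lambda>. x \<le> \<xi>})" by blast
    moreover have "s = rep ?t"
      using \<open>s \<in> Sbar\<close> v rep_of_translate by simp
    ultimately show "s \<in> rep ` (\<Union>\<xi>\<in>fiber A u. Pow {x \<in> \<Lambda>. x \<le> \<xi>})" by blast
  qed
  show "finite (rep ` (\<Union>\<xi>\<in>fiber A u. Pow {x \<in> \<Lambda>. x \<le> \<xi>}))"
    using finite_fiber finite_le by auto
qed

lemma fiber_nonempty_if_simplex:
  assumes "s \<in> S"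
  shows "fiber A (A *v vec_max s) \<noteq> {}"
proof -
  obtain v where "v \<in> \<Lambda>" "0 \<le> vec_max s + v"
    using assms translate_nonneg by metis
  then have "vec_max s + v \<in> fiber A (A *v vec_max s)"
    using kernel by (simp add: fiber_def matrix_vector_right_distrib)
  then show ?thesis by blast
qed

text \<open>A finite set containing every exponent that occurs in the Cauchy product at
  \<open>b\<close>. Being defined by fibers alone, it is unaffected by cancellation in the
  numerator.\<close>

definition splittings :: "int ^ 'd \<Rightarrow> (int ^ 'd) set"
  where "splittings b = {u. fiber A u \<noteq> {} \<and> fiber A (b - u) \<noteq> {}}"

text \<open>Fiber points over \<open>u\<close> and \<open>b - u\<close> add up to a point \<zeta> of
  the finite fiber over \<open>b\<close>, so the first lies in the finite box between 0 and
  \<zeta>.\<close>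

lemma finite_splittings: "finite (splittings b)"
proof (rule finite_subset)
  show "splittings b \<subseteq>
      (\<lambda>\<xi>. A *v \<xi>) ` (\<Union>\<zeta>\<in>fiber A b. {\<xi>. \<forall>i. \<xi> $ i \<in> {0..\<zeta> $ i}})"
  proof
    fix u assume "u \<in> splittings b"
    then obtain \<xi> \<eta> where *: "\<xi> \<in> fiber A u" "\<eta> \<in> fiber A (b - u)"
      by (auto simp: splittings_def)
    then have "\<xi> + \<eta> \<in> fiber A b" "\<forall>i. \<xi> $ i \<in> {0..(\<xi> + \<eta>) $ i}" "u = A *v \<xi>"
      by (auto simp: fiber_def matrix_vector_right_distrib less_eq_vec_def)
    then show "u \<in> (\<lambda>\<xi>. A *v \<xi>) ` (\<Union>\<zeta>\<in>fiber A b. {\<xi>. \<forall>i. \<xi> $ i \<in> {0..\<zeta> $ i}})"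
      by blast
  qed
  show "finite ((\<lambda>\<xi>. A *v \<xi>) ` (\<Union>\<zeta>\<in>fiber A b. {\<xi>. \<forall>i. \<xi> $ i \<in> {0..\<zeta> $ i}}))"
    by (intro finite_imageI finite_UN_I finite_fiber finite_int_vec_box)
qed

lemma numerator_series_eq:
  "numerator_series A Sbar u = (\<Sum>s\<in>simplices u. (- 1) ^ simplex_dim s)"
  by (simp add: numerator_series_def simplices_def)

lemma product_support:
  "{u. numerator_series A Sbar u \<noteq> 0 \<and>
      laurent_prod (\<lambda>i. geometric_series (column i A)) (b - u) \<noteq> 0} \<subseteq> splittings b"
proof clarify
  fix u assume u: "numerator_series A Sbar u \<noteq> 0"
    "laurent_prod (\<lambda>i. geometric_series (column i A)) (b - u) \<noteq> 0"
  then have "simplices u \<noteq> {}" by (auto simp: numerator_series_eq)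
  then have "fiber A u \<noteq> {}"
    using Sbar_sub fiber_nonempty_if_simplex by (auto simp: simplices_def)
  moreover have "fiber A (b - u) \<noteq> {}"
    using u by (auto simp: laurent_prod_geometric)
  ultimately show "u \<in> splittings b" by (simp add: splittings_def)
qed

lemma f_series_is_defined: "f_series_defined A Sbar"
  unfolding f_series_defined_def laurent_mult_defined_def
  using finite_simplices laurent_prod_defined_geometric
    finite_subset[OF product_support finite_splittings]
  by (simp add: simplices_def)

text \<open>The terms of the expanded Cauchy product; \<open>u\<close> is kept explicit so that the
  iterated sums become one sum over this set.\<close>

definition contributions :: "int ^ 'd \<Rightarrow> ((int ^ 'd) \<times> (int ^ 'n) set \<times> (int ^ 'n)) set"
  where "contributions b = (SIGMA u:splittings b. simplices u \<times> fiber A (b - u))"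

lemma finite_contributions: "finite (contributions b)"
  unfolding contributions_def
  by (intro finite_SigmaI finite_cartesian_product finite_splittings finite_simplices finite_fiber)

lemma f_series_eq_sum_contributions:
  "f_series A Sbar b = (\<Sum>(u, s, \<eta>)\<in>contributions b. (- 1) ^ simplex_dim s)"
proof -
  have "f_series A Sbar b = (\<Sum>u\<in>splittings b. numerator_series A Sbar u *
      laurent_prod (\<lambda>i. geometric_series (column i A)) (b - u))"
    unfolding f_series_def laurent_mult_def
    by (rule sum.mono_neutral_left[OF finite_splittings product_support]) auto
  also have "\<dots> = (\<Sum>u\<in>splittings b. \<Sum>s\<in>simplices u. \<Sum>\<eta>\<in>fiber A (b - u). (- 1) ^ simplex_dim s)"
    by (simp add: numerator_series_eq laurent_prod_geometric sum_distrib_left mult.commute)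
  also have "\<dots> = (\<Sum>(u, s, \<eta>)\<in>contributions b. (- 1) ^ simplex_dim s)"
    unfolding contributions_def sum.cartesian_product
    by (subst sum.Sigma)
      (auto intro: finite_splittings finite_simplices finite_fiber finite_cartesian_product
        simp: case_prod_unfold)
  finally show ?thesis .
qed

text \<open>Translating \<open>s\<close> by the lattice vector
  \<open>\<xi> - \<eta> - vec_max s\<close> gives a simplex with maximum
  \<open>\<xi> - \<eta>\<close>. Conversely, \<open>t\<close> comes from \<open>s = rep t\<close>
  and \<open>\<eta> = \<xi> - vec_max t\<close>.\<close>

lemma bij_betw_contributions_of_class:
  assumes \<xi>: "\<xi> \<in> fiber A b"
  shows "bij_betw (\<lambda>(u, s, \<eta>). (\<lambda>x. x + - (vec_max s + \<eta> - \<xi>)) ` s)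
    {(u, s, \<eta>). (u, s, \<eta>) \<in> contributions b \<and> vec_max s + \<eta> - \<xi> \<in> \<Lambda>}
    {t. t \<in> S \<and> vec_max t \<le> \<xi>}" (is "bij_betw ?f ?X ?Y")
proof (rule bij_betw_imageI)
  \<comment> \<open>These facts also give injectivity: the maximum of the image determines \<eta>,
    its representative is \<open>s\<close>, and \<open>s\<close> determines
    \<open>u\<close>.\<close>
  have img: "?f (u, s, \<eta>) \<in> S" "vec_max (?f (u, s, \<eta>)) = \<xi> - \<eta>" "0 \<le> \<eta>"
    "s = rep (?f (u, s, \<eta>))" "u = A *v vec_max s"
    if "(u, s, \<eta>) \<in> ?X" for u s \<eta>
  proof -
    have s: "s \<in> Sbar" "s \<in> S" and v: "- (vec_max s + \<eta> - \<xi>) \<in> \<Lambda>"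
      using that Sbar_sub minus_in[of "vec_max s + \<eta> - \<xi>"] by (auto simp: contributions_def simplices_def)
    show "?f (u, s, \<eta>) \<in> S" "s = rep (?f (u, s, \<eta>))"
      using translate_S[OF s(2) v] rep_of_translate[OF s(1) v] by simp_all
    show "vec_max (?f (u, s, \<eta>)) = \<xi> - \<eta>"
      by (simp only: prod.case vec_max_translate_S[OF s(2)]) simp
    show "0 \<le> \<eta>" "u = A *v vec_max s"
      using that by (auto simp: contributions_def fiber_def simplices_def)
  qed
  show "inj_on ?f ?X"
  proof (rule inj_onI)
    fix p q assume p: "p \<in> ?X" and q: "q \<in> ?X" and eq: "?f p = ?f q"
    obtain u s \<eta> where p': "p = (u, s, \<eta>)" by (cases p)
    obtain u' s' \<eta>' where q': "q = (u', s', \<eta>')" by (cases q)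
    note P = img[OF p[unfolded p']] and Q = img[OF q[unfolded q']]
    have e: "?f (u, s, \<eta>) = ?f (u', s', \<eta>')"
      using eq p' q' by simp
    have "\<xi> - \<eta> = \<xi> - \<eta>'"
      using P(2) Q(2) unfolding e by (rule trans[OF sym])
    moreover have "s = s'"
      using P(4) Q(4) unfolding e by (rule trans[OF _ sym])
    ultimately show "p = q"
      using P(5) Q(5) p' q' by simp
  qed
  show "?f ` ?X = ?Y"
  proof (intro subset_antisym subsetI)
    fix t assume "t \<in> ?f ` ?X"
    then obtain p where p: "p \<in> ?X" "t = ?f p" by blast
    obtain u s \<eta> where p': "p = (u, s, \<eta>)" by (cases p)
    note P = img[OF p(1)[unfolded p']]
    show "t \<in> ?Y"
      using P(1,2,3) unfolding p(2) p' by (simp only: mem_Collect_eq) (simp add: less_eq_vec_def)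
  next
    fix t assume t: "t \<in> ?Y"
    obtain v where v: "v \<in> \<Lambda>" "rep t = (\<lambda>x. x + v) ` t"
      using rep_translate t by blast
    have max: "vec_max (rep t) = vec_max t + v"
      using v t vec_max_translate_S by simp
    define \<eta> where "\<eta> = \<xi> - vec_max t"
    define u where "u = A *v vec_max (rep t)"
    have shift: "vec_max (rep t) + \<eta> - \<xi> = v"
      by (simp add: max \<eta>_def)
    have "u = A *v vec_max t"
      using kernel v(1) by (simp add: u_def max matrix_vector_right_distrib)
    then have \<eta>: "\<eta> \<in> fiber A (b - u)"
      using \<xi> t by (simp add: \<eta>_def fiber_def less_eq_vec_def matrix_vector_mult_diff_distrib)
    moreover have "fiber A u \<noteq> {}"
      unfolding u_def using rep_translate(1) t Sbar_sub
      by (intro fiber_nonempty_if_simplex) blast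
    moreover have "rep t \<in> simplices u"
      using t rep_translate by (simp add: simplices_def u_def)
    ultimately have "(u, rep t, \<eta>) \<in> contributions b"
      by (auto simp: contributions_def splittings_def)
    then have "(u, rep t, \<eta>) \<in> ?X"
      using shift v by simp
    moreover have "?f (u, rep t, \<eta>) = t"
      by (simp only: prod.case shift) (simp add: v(2) image_image)
    ultimately show "t \<in> ?f ` ?X"
      by (rule rev_image_eqI[OF _ sym])
  qed
qed

text \<open>Translation preserves dimension, so the bijection turns this sum into the Euler
  characteristic of the simplices with maximum \<le> \<xi>.\<close>

lemma sum_contributions_of_class:
  assumes \<xi>: "\<xi> \<in> fiber A b"
  shows "(\<Sum>(u, s, \<eta>) | (u, s, \<eta>) \<in> contributions b \<and> vec_max s + \<eta> - \<xi> \<in> \<Lambda>.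
    (- 1 :: int) ^ simplex_dim s) = 1"
proof -
  let ?f = "\<lambda>(u, s, \<eta>). (\<lambda>x. x + - (vec_max s + \<eta> - \<xi>)) ` s"
  let ?X = "{(u, s, \<eta>). (u, s, \<eta>) \<in> contributions b \<and> vec_max s + \<eta> - \<xi> \<in> \<Lambda>}"
  have "(\<Sum>(u, s, \<eta>)\<in>?X. (- 1 :: int) ^ simplex_dim s) = (\<Sum>p\<in>?X. (- 1) ^ simplex_dim (?f p))"
    by (intro sum.cong refl) (simp add: case_prod_unfold simplex_dim_translate del: add_uminus_conv_diff)
  also have "\<dots> = (\<Sum>t | t \<in> S \<and> vec_max t \<le> \<xi>. (- 1) ^ simplex_dim t)"
    by (rule sum.reindex_bij_betw[OF bij_betw_contributions_of_class[OF \<xi>]])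
  also have "\<dots> = 1"
    using \<xi> by (intro euler_characteristic) (simp add: fiber_def)
  finally show ?thesis .
qed

lemma f_series_eq_num_classes: "f_series A Sbar b = int (num_classes A \<Lambda> b)"
proof -
  define R where "R = {(\<xi>, \<eta>). \<xi> \<in> fiber A b \<and> \<eta> \<in> fiber A b \<and> \<xi> - \<eta> \<in> \<Lambda>}"
  \<comment> \<open>\<open>vec_max s + \<eta>\<close> may have negative coordinates and so lie
    outside the fiber; its class is therefore given as the set of fiber points congruent to it
    modulo \<Lambda>.\<close>
  define cls where "cls = (\<lambda>(u :: int ^ 'd, s, \<eta>). {\<zeta> \<in> fiber A b. vec_max s + \<eta> - \<zeta> \<in> \<Lambda>})"
  have fin: "finite (fiber A b // R)"
    using finite_fiber by (auto simp: quotient_def)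
  have "cls p \<in> fiber A b // R" if p: "p \<in> contributions b" for p
  proof -
    obtain u s \<eta> where p': "p = (u, s, \<eta>)" by (cases p)
    have s: "s \<in> S" "A *v vec_max s = u" and \<eta>: "\<eta> \<in> fiber A (b - u)"
      using p p' Sbar_sub by (auto simp: contributions_def simplices_def)
    then obtain v where v: "v \<in> \<Lambda>" "0 \<le> vec_max s + v"
      using translate_nonneg by metis
    \<comment> \<open>Adding \<open>v\<close> changes neither the coset nor the image under
      \<open>A\<close>, and it brings the vector into the fiber, so the class is nonempty.\<close>
    let ?\<xi> = "vec_max s + v + \<eta>"
    have "?\<xi> \<in> fiber A b"
      using s \<eta> v kernel
      by (auto simp: fiber_def less_eq_vec_def matrix_vector_right_distrib)
    moreover have "vec_max s + \<eta> - \<zeta> \<in> \<Lambda> \<longleftrightarrow> ?\<xi> - \<zeta> \<in> \<Lambda>" for \<zeta>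
    proof -
      have "?\<xi> - \<zeta> = (vec_max s + \<eta> - \<zeta>) + v" by simp
      then show ?thesis
        using add_in[OF _ v(1)] diff_in[OF _ v(1)] by (metis add_diff_cancel_right')
    qed
    ultimately have "cls p = R `` {?\<xi>}"
      by (auto simp: cls_def p' R_def)
    then show ?thesis
      using \<open>?\<xi> \<in> fiber A b\<close> by (simp add: quotientI)
  qed
  then have cls: "cls ` contributions b \<subseteq> fiber A b // R" by blast
  have one: "(\<Sum>p | p \<in> contributions b \<and> cls p = C. (\<lambda>(u, s, \<eta>). (- 1 :: int) ^ simplex_dim s) p) = 1"
    if C: "C \<in> fiber A b // R" for C
  proof -
    obtain \<xi> where \<xi>: "\<xi> \<in> fiber A b" "C = R `` {\<xi>}"
      using C by (auto elim: quotientE)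
    have "cls (u, s, \<eta>) = C \<longleftrightarrow> vec_max s + \<eta> - \<xi> \<in> \<Lambda>" for u s \<eta>
    proof
      assume "cls (u, s, \<eta>) = C"
      moreover have "\<xi> \<in> C" using \<xi> zero_in by (simp add: R_def)
      ultimately show "vec_max s + \<eta> - \<xi> \<in> \<Lambda>" by (auto simp: cls_def)
    next
      assume *: "vec_max s + \<eta> - \<xi> \<in> \<Lambda>"
      have "vec_max s + \<eta> - \<zeta> \<in> \<Lambda> \<longleftrightarrow> \<xi> - \<zeta> \<in> \<Lambda>" for \<zeta>
        using add_in[OF *, of "\<xi> - \<zeta>"] diff_in[OF _ *, of "vec_max s + \<eta> - \<zeta>"]
        by (auto simp: algebra_simps)
      then show "cls (u, s, \<eta>) = C"
        using \<xi> by (auto simp: cls_def R_def)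
    qed
    then have "{p. p \<in> contributions b \<and> cls p = C}
        = {(u, s, \<eta>). (u, s, \<eta>) \<in> contributions b \<and> vec_max s + \<eta> - \<xi> \<in> \<Lambda>}"
      by auto
    then show ?thesis
      using sum_contributions_of_class[OF \<xi>(1)] by simp
  qed
  \<comment> \<open>Grouped by class, the contributions sum to 1 in each, so the total counts the
    classes.\<close>
  have "f_series A Sbar b = (\<Sum>C\<in>fiber A b // R.
      \<Sum>p | p \<in> contributions b \<and> cls p = C. (\<lambda>(u, s, \<eta>). (- 1) ^ simplex_dim s) p)"
    unfolding f_series_eq_sum_contributions by (rule sum.group[OF finite_contributions fin cls, symmetric])
  also have "\<dots> = (\<Sum>C\<in>fiber A b // R. 1)"
    by (rule sum.cong[OF refl one])
  finally show ?thesis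
    by (simp add: num_classes_def R_def)
qed

end

section \<open>The generic and the perturbed case together\<close>

theorem theorem1p4:
  fixes A :: "int ^ 'n ^ 'd"
    and l :: "real ^ 'd"
    and \<Lambda> :: "(int ^ 'n) set"
    and \<phi> :: "int ^ 'n \<Rightarrow> real ^ 'n"
    and Sbar :: "(int ^ 'n) set set"
  assumes "\<And>i. l \<bullet> (\<chi> j. real_of_int (column i A $ j)) < 0"
    and "is_lattice \<Lambda>"
    and "\<And>v. v \<in> \<Lambda> \<Longrightarrow> A *v v = 0"
    and "\<not> generic \<Lambda> \<Longrightarrow> proper_perturbation \<Lambda> \<phi>"
    and "representatives \<Lambda> (neighborhood_complex \<Lambda> \<phi>) Sbar"
  shows "f_series_defined A Sbar \<and> f_series A Sbar = (\<lambda>b. int (num_classes A \<Lambda> b))"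
proof -
  \<comment> \<open>One family of relations covers both cases. For generic \<Lambda> it inherits its
    properties from the order on the integers; otherwise the second and third clauses of
    \<open>proper_perturbation\<close> provide \<open>below_le\<close> and
    \<open>below_add\<close>.\<close>
  define below where
    "below i x y \<longleftrightarrow> (if generic \<Lambda> then x $ i < y $ i else \<phi> x $ i < \<phi> y $ i)" for i x y
  interpret neighborhood A l \<Lambda> below
  proof
    fix i x y v assume *: "x \<in> \<Lambda>" "y \<in> \<Lambda>" "below i x y"
    show "x $ i \<le> y $ i"
      using * assms(4) by (auto simp: below_def proper_perturbation_def split: if_splits)
    show "below i (x + v) (y + v)" if "v \<in> \<Lambda>"
      using * that assms(4) by (auto simp: below_def proper_perturbation_def split: if_splits)
  qed (use assms in \<open>auto simp: below_def\<close>)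
  have "(if generic \<Lambda> then v \<lless> vec_max s else \<phi> v \<lless> vec_max (\<phi> ` s))
      \<longleftrightarrow> (\<forall>i. \<exists>y\<in>s. below i v y)" if "finite s" "s \<noteq> {}" for v s
    using that by (simp add: below_def vec_less_vec_max_iff)
  then have "neighborhood_complex \<Lambda> \<phi> = S"
    unfolding neighborhood_complex_def S_def by (intro Collect_cong) (metis (no_types, lifting))
  then interpret neighborhood_representatives A l \<Lambda> below Sbar
    by unfold_locales (use assms in simp)
  show ?thesis
    using f_series_is_defined f_series_eq_num_classes by blast
qed

end
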